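(* Let $h:R\to S$ be a homomorphism of rings and let $h(u)=v$, where $u\in R$ is a regular element (i.e. a non-zero-divisor). Consider the induced homomorphisms $$\overline h:R\to S/(v),\qquad \phi:u^{-1}R\to v^{-1}S.$$ Denote $I=\ker(\overline h)$, let $Q\subseteq R$ be a set of representatives of the cosets $R/I$, let $T\subseteq R$ be a subset, and for $t\in T$ let $q(t)\in Q$ denote the representative of the coset $t+I$. Assume: (1) the set $T\cup Q$ generates $R$ as a ring; (2) the set $\{t-q(t)\mid t\in T\}$ generates $I$ as an ideal; (3) the homomorphism $\overline h$ is onto. Then there exist unique elements $t_i\in\phi^{-1}S$ and $q_{t,i}\in Q$, for $t\in T$ and $i\in\mathbb{N}_0$, such that $$t_0=t,\qquad u\,t_{i+1}=t_i-q_{t,i}.$$ Additionally, the set $Q\cup\{t_i\mid t\in T,\ i\in\mathbb{N}_0\}$ generates the ring $\phi^{-1}S\subseteq u^{-1}R$.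
   Context: All rings are commutative, associative and unital. $\mathbb{N}_0$ is the set of non-negative integers. A set of representatives contains exactly one element of each coset. $u^{-1}R$ and $v^{-1}S$ denote the localizations obtained by inverting $u$ and $v$, respectively; since $u$ is regular, $R$ is regarded as a subring of $u^{-1}R$. $\phi^{-1}S$ denotes the preimage under $\phi$ of (the image of) $S$ in $v^{-1}S$.
   Formalization: Added assumption: every element of S killed by a power of v lies in (v) (automatic if v is regular). Without it uniqueness fails, e.g. R = Z[u], S = Z, h(u) = 0, Q = Z, T = {u}. *)

theory Defs
  imports "HOL-Algebra.QuotRing" "HOL-Algebra.Generated_Rings"
begin

section \<open>Localization of a commutative ring\<close>

text \<open>The denominators may be zero divisors (or zero), hence the extra factor \<open>w\<close>.\<close>

definition frac_rel :: "('a, 'm) ring_scheme \<Rightarrow> 'a set \<Rightarrow> (('a \<times> 'a) \<times> ('a \<times> 'a)) set" where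
  "frac_rel R M = {((a, s), (b, t)). a \<in> carrier R \<and> s \<in> M \<and> b \<in> carrier R \<and> t \<in> M \<and>
     (\<exists>w\<in>M. w \<otimes>\<^bsub>R\<^esub> (t \<otimes>\<^bsub>R\<^esub> a) = w \<otimes>\<^bsub>R\<^esub> (s \<otimes>\<^bsub>R\<^esub> b))}"

definition fraction :: "('a, 'm) ring_scheme \<Rightarrow> 'a set \<Rightarrow> 'a \<Rightarrow> 'a \<Rightarrow> ('a \<times> 'a) set" where
  "fraction R M a s = frac_rel R M `` {(a, s)}"

definition localization :: "('a, 'm) ring_scheme \<Rightarrow> 'a set \<Rightarrow> ('a \<times> 'a) set ring" where
  "localization R M =
    \<lparr>carrier = (carrier R \<times> M) // frac_rel R M,
     mult = (\<lambda>A B. \<Union>(a, s)\<in>A. \<Union>(b, t)\<in>B. fraction R M (a \<otimes>\<^bsub>R\<^esub> b) (s \<otimes>\<^bsub>R\<^esub> t)),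
     one = fraction R M \<one>\<^bsub>R\<^esub> \<one>\<^bsub>R\<^esub>,
     zero = fraction R M \<zero>\<^bsub>R\<^esub> \<one>\<^bsub>R\<^esub>,
     add = (\<lambda>A B. \<Union>(a, s)\<in>A. \<Union>(b, t)\<in>B.
       fraction R M (t \<otimes>\<^bsub>R\<^esub> a \<oplus>\<^bsub>R\<^esub> s \<otimes>\<^bsub>R\<^esub> b) (s \<otimes>\<^bsub>R\<^esub> t))\<rparr>"

definition to_localization :: "('a, 'm) ring_scheme \<Rightarrow> 'a set \<Rightarrow> 'a \<Rightarrow> ('a \<times> 'a) set" where
  "to_localization R M a = fraction R M a \<one>\<^bsub>R\<^esub>"

definition localization_map ::
  "('b, 'n) ring_scheme \<Rightarrow> 'b set \<Rightarrow> ('a \<Rightarrow> 'b) \<Rightarrow> ('a \<times> 'a) set \<Rightarrow> ('b \<times> 'b) set" where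
  "localization_map S N h A = (\<Union>(a, s)\<in>A. fraction S N (h a) (h s))"

definition powers_of :: "('a, 'm) ring_scheme \<Rightarrow> 'a \<Rightarrow> 'a set" where
  "powers_of R u = range (\<lambda>n::nat. u [^]\<^bsub>R\<^esub> n)"

lemma (in cring) submonoid_powers_of:
  assumes "u \<in> carrier R"
  shows "submonoid (powers_of R u) R"
proof
  show "powers_of R u \<subseteq> carrier R"
    using assms by (auto simp: powers_of_def)
  show "\<one> \<in> powers_of R u"
    unfolding powers_of_def by (rule range_eqI[of _ _ 0]) simp
  fix x y assume "x \<in> powers_of R u" "y \<in> powers_of R u"
  then show "x \<otimes> y \<in> powers_of R u"
    using assms by (auto simp: powers_of_def nat_pow_mult)
qed

text \<open>The operations above do not depend on the representatives, and they have the
  expected values on fractions.\<close>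

lemma (in cring) frac_rel_equiv:
  assumes "submonoid M R"
  shows "equiv (carrier R \<times> M) (frac_rel R M)"
proof -
  interpret M: submonoid M R by fact
  note sub = subsetD[OF M.subset]
  show ?thesis
  proof (rule equivI)
    show "frac_rel R M \<subseteq> (carrier R \<times> M) \<times> (carrier R \<times> M)"
      by (auto simp: frac_rel_def)
    show "refl_on (carrier R \<times> M) (frac_rel R M)"
      by (rule refl_onI) (auto simp: frac_rel_def intro!: bexI[OF _ M.one_closed])
    show "sym (frac_rel R M)"
      by (rule symI) (force simp: frac_rel_def)
    show "trans (frac_rel R M)"
    proof (rule transI, clarify)
      fix a s b t c p
      assume "((a, s), (b, t)) \<in> frac_rel R M" "((b, t), (c, p)) \<in> frac_rel R M"
      then obtain w w' where mem: "a \<in> carrier R" "b \<in> carrier R" "c \<in> carrier R"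
          "s \<in> M" "t \<in> M" "p \<in> M" "w \<in> M" "w' \<in> M"
        and e1: "w \<otimes> (t \<otimes> a) = w \<otimes> (s \<otimes> b)" and e2: "w' \<otimes> (p \<otimes> b) = w' \<otimes> (t \<otimes> c)"
        by (auto simp: frac_rel_def)
      note car = mem(1-3) mem(4-8)[THEN sub]
      have "(w \<otimes> w' \<otimes> t) \<otimes> (p \<otimes> a) = w' \<otimes> p \<otimes> (w \<otimes> (t \<otimes> a))"
        using car by (simp add: m_ac)
      also have "\<dots> = w \<otimes> s \<otimes> (w' \<otimes> (p \<otimes> b))"
        unfolding e1 using car by (simp add: m_ac)
      also have "\<dots> = (w \<otimes> w' \<otimes> t) \<otimes> (s \<otimes> c)"
        unfolding e2 using car by (simp add: m_ac)
      finally show "((a, s), (c, p)) \<in> frac_rel R M"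
        using mem unfolding frac_rel_def by (auto intro!: bexI[of _ "w \<otimes> w' \<otimes> t"])
    qed
  qed
qed

lemma (in cring) frac_eq_iff:
  assumes "submonoid M R" "a \<in> carrier R" "s \<in> M" "b \<in> carrier R" "t \<in> M"
  shows "fraction R M a s = fraction R M b t \<longleftrightarrow> (\<exists>w\<in>M. w \<otimes> (t \<otimes> a) = w \<otimes> (s \<otimes> b))"
proof -
  have "fraction R M a s = fraction R M b t \<longleftrightarrow> ((a, s), (b, t)) \<in> frac_rel R M"
    unfolding fraction_def
    using eq_equiv_class_iff[OF frac_rel_equiv[OF assms(1)]] assms(2-) by simp
  then show ?thesis
    using assms(2-) by (simp add: frac_rel_def)
qed

lemma (in cring) frac_closed:
  assumes "a \<in> carrier R" "s \<in> M"
  shows "fraction R M a s \<in> carrier (localization R M)"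
  using assms by (auto simp: localization_def fraction_def intro!: quotientI)

lemma (in cring) localization_cases:
  assumes "A \<in> carrier (localization R M)"
  obtains a s where "a \<in> carrier R" "s \<in> M" "A = fraction R M a s"
  using assms by (auto simp: localization_def fraction_def elim!: quotientE)

lemma (in cring) UN_frac:
  assumes "submonoid M R" "a \<in> carrier R" "s \<in> M"
    and "\<And>b t. \<lbrakk>b \<in> carrier R; t \<in> M; fraction R M b t = fraction R M a s\<rbrakk> \<Longrightarrow> F b t = C"
  shows "(\<Union>(b, t)\<in>fraction R M a s. F b t) = C"
proof -
  have "F b t = C" if "(b, t) \<in> fraction R M a s" for b t
  proof -
    have r: "((a, s), (b, t)) \<in> frac_rel R M"
      using that by (simp add: fraction_def)
    then have "fraction R M b t = fraction R M a s"
      unfolding fraction_def using equiv_class_eq[OF frac_rel_equiv[OF assms(1)] r] by simp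
    with r show ?thesis
      using assms(4) by (simp add: frac_rel_def)
  qed
  moreover have "(a, s) \<in> fraction R M a s"
    unfolding fraction_def using equiv_class_self[OF frac_rel_equiv[OF assms(1)], of "(a, s)"] assms
    by simp
  ultimately show ?thesis by fastforce
qed

lemma (in cring) localization_mult:
  assumes M: "submonoid M R" and mem: "a \<in> carrier R" "s \<in> M" "b \<in> carrier R" "t \<in> M"
  shows "fraction R M a s \<otimes>\<^bsub>localization R M\<^esub> fraction R M b t = fraction R M (a \<otimes> b) (s \<otimes> t)"
proof -
  interpret M: submonoid M R by fact
  note sub = subsetD[OF M.subset]
  have *: "fraction R M (a' \<otimes> b') (s' \<otimes> t') = fraction R M (a \<otimes> b) (s \<otimes> t)"
    if m: "a' \<in> carrier R" "s' \<in> M" "b' \<in> carrier R" "t' \<in> M"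
      and e: "fraction R M a' s' = fraction R M a s" "fraction R M b' t' = fraction R M b t" for a' s' b' t'
  proof -
    obtain w w' where w: "w \<in> M" "w' \<in> M" and e1: "w \<otimes> (s \<otimes> a') = w \<otimes> (s' \<otimes> a)"
      and e2: "w' \<otimes> (t \<otimes> b') = w' \<otimes> (t' \<otimes> b)"
      using e m mem by (auto simp: frac_eq_iff[OF M])
    note car = m mem w m(2,4)[THEN sub] mem(2,4)[THEN sub] w[THEN sub]
    have "(w \<otimes> w') \<otimes> ((s \<otimes> t) \<otimes> (a' \<otimes> b')) = (w \<otimes> (s \<otimes> a')) \<otimes> (w' \<otimes> (t \<otimes> b'))"
      using car by (simp add: m_ac)
    also have "\<dots> = (w \<otimes> w') \<otimes> ((s' \<otimes> t') \<otimes> (a \<otimes> b))"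
      unfolding e1 e2 using car by (simp add: m_ac)
    finally show ?thesis
      using car by (subst frac_eq_iff[OF M]) (auto intro!: bexI[of _ "w \<otimes> w'"])
  qed
  have "fraction R M a s \<otimes>\<^bsub>localization R M\<^esub> fraction R M b t =
      (\<Union>(a, s)\<in>fraction R M a s. \<Union>(b, t)\<in>fraction R M b t. fraction R M (a \<otimes> b) (s \<otimes> t))"
    by (simp add: localization_def)
  also have "\<dots> = fraction R M (a \<otimes> b) (s \<otimes> t)"
    by (rule UN_frac[OF M mem(1,2)], rule UN_frac[OF M mem(3,4)], rule *)
  finally show ?thesis .
qed

lemma (in cring) localization_add:
  assumes M: "submonoid M R" and mem: "a \<in> carrier R" "s \<in> M" "b \<in> carrier R" "t \<in> M"
  shows "fraction R M a s \<oplus>\<^bsub>localization R M\<^esub> fraction R M b t =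
    fraction R M (t \<otimes> a \<oplus> s \<otimes> b) (s \<otimes> t)"
proof -
  interpret M: submonoid M R by fact
  note sub = subsetD[OF M.subset]
  have *: "fraction R M (t' \<otimes> a' \<oplus> s' \<otimes> b') (s' \<otimes> t') = fraction R M (t \<otimes> a \<oplus> s \<otimes> b) (s \<otimes> t)"
    if m: "a' \<in> carrier R" "s' \<in> M" "b' \<in> carrier R" "t' \<in> M"
      and e: "fraction R M a' s' = fraction R M a s" "fraction R M b' t' = fraction R M b t" for a' s' b' t'
  proof -
    obtain w w' where w: "w \<in> M" "w' \<in> M" and e1: "w \<otimes> (s \<otimes> a') = w \<otimes> (s' \<otimes> a)"
      and e2: "w' \<otimes> (t \<otimes> b') = w' \<otimes> (t' \<otimes> b)"
      using e m mem by (auto simp: frac_eq_iff[OF M])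
    note car = m mem w m(2,4)[THEN sub] mem(2,4)[THEN sub] w[THEN sub]
    have "(w \<otimes> w') \<otimes> ((s \<otimes> t) \<otimes> (t' \<otimes> a' \<oplus> s' \<otimes> b')) =
        (w \<otimes> (s \<otimes> a')) \<otimes> (w' \<otimes> t \<otimes> t') \<oplus> (w' \<otimes> (t \<otimes> b')) \<otimes> (w \<otimes> s \<otimes> s')"
      using car by (simp add: m_ac r_distr l_distr)
    also have "\<dots> = (w \<otimes> w') \<otimes> ((s' \<otimes> t') \<otimes> (t \<otimes> a \<oplus> s \<otimes> b))"
      unfolding e1 e2 using car by (simp add: m_ac r_distr l_distr)
    finally show ?thesis
      using car by (subst frac_eq_iff[OF M]) (auto intro!: bexI[of _ "w \<otimes> w'"])
  qed
  have "fraction R M a s \<oplus>\<^bsub>localization R M\<^esub> fraction R M b t =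
      (\<Union>(a, s)\<in>fraction R M a s. \<Union>(b, t)\<in>fraction R M b t. fraction R M (t \<otimes> a \<oplus> s \<otimes> b) (s \<otimes> t))"
    by (simp add: localization_def)
  also have "\<dots> = fraction R M (t \<otimes> a \<oplus> s \<otimes> b) (s \<otimes> t)"
    by (rule UN_frac[OF M mem(1,2)], rule UN_frac[OF M mem(3,4)], rule *)
  finally show ?thesis .
qed

lemma localization_map_frac:
  assumes "cring R" "cring S" and h: "h \<in> ring_hom R S"
    and M: "submonoid M R" and N: "submonoid N S" and MN: "h ` M \<subseteq> N"
    and mem: "a \<in> carrier R" "s \<in> M"
  shows "localization_map S N h (fraction R M a s) = fraction S N (h a) (h s)"
proof -
  interpret R: cring R by fact
  interpret S: cring S by fact
  interpret M: submonoid M R by fact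
  show ?thesis
    unfolding localization_map_def
  proof (rule R.UN_frac[OF M mem])
    fix b t assume m: "b \<in> carrier R" "t \<in> M" and "fraction R M b t = fraction R M a s"
    then obtain w where w: "w \<in> M" and e: "w \<otimes>\<^bsub>R\<^esub> (s \<otimes>\<^bsub>R\<^esub> b) = w \<otimes>\<^bsub>R\<^esub> (t \<otimes>\<^bsub>R\<^esub> a)"
      using mem by (auto simp: R.frac_eq_iff[OF M])
    have car: "w \<in> carrier R" "s \<in> carrier R" "t \<in> carrier R"
      using m mem w M.subset by auto
    have "h w \<otimes>\<^bsub>S\<^esub> (h s \<otimes>\<^bsub>S\<^esub> h b) = h w \<otimes>\<^bsub>S\<^esub> (h t \<otimes>\<^bsub>S\<^esub> h a)"
      using arg_cong[OF e, of h] car m mem by (simp add: ring_hom_mult[OF h])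
    then show "fraction S N (h b) (h t) = fraction S N (h a) (h s)"
      using w m mem MN ring_hom_closed[OF h] by (subst S.frac_eq_iff[OF N]) auto
  qed
qed

lemma (in cring) localization_cring:
  assumes M: "submonoid M R"
  shows "cring (localization R M)"
proof -
  interpret M: submonoid M R by fact
  let ?L = "localization R M"
  have sub: "x \<in> carrier R" if "x \<in> M" for x using that M.subset by auto
  have one: "\<one>\<^bsub>?L\<^esub> = fraction R M \<one> \<one>" and zero: "\<zero>\<^bsub>?L\<^esub> = fraction R M \<zero> \<one>"
    by (simp_all add: localization_def)
  have eqI: "fraction R M a s = fraction R M b t"
    if "a \<in> carrier R" "s \<in> M" "b \<in> carrier R" "t \<in> M" "t \<otimes> a = s \<otimes> b" for a s b t
    using that by (subst frac_eq_iff[OF M]) (auto intro!: bexI[OF _ M.one_closed])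
  note rules = localization_add[OF M] localization_mult[OF M] one zero sub
  have add_closed: "A \<oplus>\<^bsub>?L\<^esub> B \<in> carrier ?L" and mult_closed: "A \<otimes>\<^bsub>?L\<^esub> B \<in> carrier ?L"
    and add_comm: "A \<oplus>\<^bsub>?L\<^esub> B = B \<oplus>\<^bsub>?L\<^esub> A" and mult_comm: "A \<otimes>\<^bsub>?L\<^esub> B = B \<otimes>\<^bsub>?L\<^esub> A"
    if AB: "A \<in> carrier ?L" "B \<in> carrier ?L" for A B
  proof -
    obtain a s b t where m: "a \<in> carrier R" "s \<in> M" "b \<in> carrier R" "t \<in> M"
      and A: "A = fraction R M a s" and B: "B = fraction R M b t"
      using AB by (metis localization_cases)
    note car = m sub[OF m(2)] sub[OF m(4)]
    show "A \<oplus>\<^bsub>?L\<^esub> B \<in> carrier ?L" "A \<otimes>\<^bsub>?L\<^esub> B \<in> carrier ?L"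
      unfolding A B using car by (simp_all add: rules frac_closed)
    show "A \<oplus>\<^bsub>?L\<^esub> B = B \<oplus>\<^bsub>?L\<^esub> A" "A \<otimes>\<^bsub>?L\<^esub> B = B \<otimes>\<^bsub>?L\<^esub> A"
      unfolding A B using car by (simp_all add: rules a_comm m_comm)
  qed
  have assoc: "A \<oplus>\<^bsub>?L\<^esub> B \<oplus>\<^bsub>?L\<^esub> C = A \<oplus>\<^bsub>?L\<^esub> (B \<oplus>\<^bsub>?L\<^esub> C)"
      "A \<otimes>\<^bsub>?L\<^esub> B \<otimes>\<^bsub>?L\<^esub> C = A \<otimes>\<^bsub>?L\<^esub> (B \<otimes>\<^bsub>?L\<^esub> C)"
      "(A \<oplus>\<^bsub>?L\<^esub> B) \<otimes>\<^bsub>?L\<^esub> C = A \<otimes>\<^bsub>?L\<^esub> C \<oplus>\<^bsub>?L\<^esub> B \<otimes>\<^bsub>?L\<^esub> C"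
    if ABC: "A \<in> carrier ?L" "B \<in> carrier ?L" "C \<in> carrier ?L" for A B C
  proof -
    obtain a s b t c p where m: "a \<in> carrier R" "b \<in> carrier R" "c \<in> carrier R"
        "s \<in> M" "t \<in> M" "p \<in> M"
      and A: "A = fraction R M a s" and B: "B = fraction R M b t" and C: "C = fraction R M c p"
      using ABC by (metis localization_cases)
    note car = m m(4-6)[THEN sub]
    show "A \<oplus>\<^bsub>?L\<^esub> B \<oplus>\<^bsub>?L\<^esub> C = A \<oplus>\<^bsub>?L\<^esub> (B \<oplus>\<^bsub>?L\<^esub> C)"
      "A \<otimes>\<^bsub>?L\<^esub> B \<otimes>\<^bsub>?L\<^esub> C = A \<otimes>\<^bsub>?L\<^esub> (B \<otimes>\<^bsub>?L\<^esub> C)"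
      unfolding A B C using car by (simp_all add: rules r_distr l_distr m_ac a_ac)
    show "(A \<oplus>\<^bsub>?L\<^esub> B) \<otimes>\<^bsub>?L\<^esub> C = A \<otimes>\<^bsub>?L\<^esub> C \<oplus>\<^bsub>?L\<^esub> B \<otimes>\<^bsub>?L\<^esub> C"
      unfolding A B C using car
      by (simp add: localization_add[OF M] localization_mult[OF M], intro eqI)
        (simp_all add: r_distr l_distr m_ac a_ac)
  qed
  have unit: "\<zero>\<^bsub>?L\<^esub> \<oplus>\<^bsub>?L\<^esub> A = A" "\<one>\<^bsub>?L\<^esub> \<otimes>\<^bsub>?L\<^esub> A = A"
      "\<exists>B\<in>carrier ?L. B \<oplus>\<^bsub>?L\<^esub> A = \<zero>\<^bsub>?L\<^esub>" if A: "A \<in> carrier ?L" for A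
  proof -
    obtain a s where m: "a \<in> carrier R" "s \<in> M" "A = fraction R M a s"
      using A by (rule localization_cases)
    note car = m sub[OF m(2)]
    show "\<zero>\<^bsub>?L\<^esub> \<oplus>\<^bsub>?L\<^esub> A = A" "\<one>\<^bsub>?L\<^esub> \<otimes>\<^bsub>?L\<^esub> A = A"
      using car by (simp_all add: rules)
    have "fraction R M (\<ominus> a) s \<oplus>\<^bsub>?L\<^esub> fraction R M a s = fraction R M \<zero> \<one>"
      using car by (simp add: localization_add[OF M] flip: r_distr, intro eqI)
        (simp_all add: l_neg)
    then show "\<exists>B\<in>carrier ?L. B \<oplus>\<^bsub>?L\<^esub> A = \<zero>\<^bsub>?L\<^esub>"
      using car by (intro bexI[of _ "fraction R M (\<ominus> a) s"]) (simp_all add: zero frac_closed)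
  qed
  have closed: "\<zero>\<^bsub>?L\<^esub> \<in> carrier ?L" "\<one>\<^bsub>?L\<^esub> \<in> carrier ?L"
    by (simp_all add: one zero frac_closed)
  show ?thesis
    by (intro cringI abelian_groupI comm_monoidI)
      (assumption | rule add_closed mult_closed closed add_comm mult_comm assoc unit)+
qed

lemma localization_map_hom:
  assumes R: "cring R" and S: "cring S" and h: "h \<in> ring_hom R S"
    and M: "submonoid M R" and N: "submonoid N S" and MN: "h ` M \<subseteq> N"
  shows "localization_map S N h \<in> ring_hom (localization R M) (localization S N)"
proof -
  interpret R: cring R by fact
  interpret S: cring S by fact
  interpret M: submonoid M R by fact
  interpret N: submonoid N S by fact
  have sub: "x \<in> carrier R" if "x \<in> M" for x using that M.subset by auto
  have MN': "h x \<in> N" if "x \<in> M" for x using that MN by auto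
  have one: "\<one>\<^bsub>localization R M\<^esub> = fraction R M \<one>\<^bsub>R\<^esub> \<one>\<^bsub>R\<^esub>"
    "\<one>\<^bsub>localization S N\<^esub> = fraction S N \<one>\<^bsub>S\<^esub> \<one>\<^bsub>S\<^esub>"
    by (simp_all add: localization_def)
  note rules = localization_map_frac[OF assms] R.localization_add[OF M] S.localization_add[OF N]
    R.localization_mult[OF M] S.localization_mult[OF N] ring_hom_mult[OF h] ring_hom_add[OF h]
    ring_hom_one[OF h] one sub MN' ring_hom_closed[OF h]
  show ?thesis
    by (rule ring_hom_memI) (auto elim!: R.localization_cases simp: rules intro!: S.frac_closed)
qed

section \<open>Residue representatives and expansions\<close>

definition coset_representatives :: "('a, 'm) ring_scheme \<Rightarrow> 'a set \<Rightarrow> 'a set \<Rightarrow> bool" where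
  "coset_representatives R I Q \<longleftrightarrow>
     Q \<subseteq> carrier R \<and> (\<forall>C\<in>a_rcosets\<^bsub>R\<^esub> I. \<exists>!q. q \<in> Q \<and> q \<in> C)"

definition residue_map :: "('b, 'n) ring_scheme \<Rightarrow> ('a \<Rightarrow> 'b) \<Rightarrow> 'b \<Rightarrow> 'a \<Rightarrow> 'b set" where
  "residue_map S h v = (\<lambda>r. (PIdl\<^bsub>S\<^esub> v) +>\<^bsub>S\<^esub> h r)"

text \<open>The subset \<open>\<phi>\<inverse>S\<close> of \<open>u\<inverse>R\<close>, where \<open>\<phi>\<close> maps \<open>u\<inverse>R\<close> to \<open>h(u)\<inverse>S\<close>.\<close>

definition integral_preimage ::
  "('a, 'm) ring_scheme \<Rightarrow> ('b, 'n) ring_scheme \<Rightarrow> ('a \<Rightarrow> 'b) \<Rightarrow> 'a \<Rightarrow> ('a \<times> 'a) set set" where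
  "integral_preimage R S h u =
     {x \<in> carrier (localization R (powers_of R u)).
        localization_map S (powers_of S (h u)) h x
          \<in> to_localization S (powers_of S (h u)) ` carrier S}"

text \<open>Elements of \<open>R\<close> are used inside \<open>u\<inverse>R\<close> through \<open>to_localization\<close>.
  Only the values of \<open>x\<close> and \<open>q\<close> at arguments in \<open>T\<close> matter.\<close>

definition expansion_family ::
  "('a, 'm) ring_scheme \<Rightarrow> ('b, 'n) ring_scheme \<Rightarrow> ('a \<Rightarrow> 'b) \<Rightarrow> 'a \<Rightarrow> 'a set \<Rightarrow> 'a set \<Rightarrow>
   ('a \<Rightarrow> nat \<Rightarrow> ('a \<times> 'a) set) \<Rightarrow> ('a \<Rightarrow> nat \<Rightarrow> 'a) \<Rightarrow> bool" where
  "expansion_family R S h u Q T x q \<longleftrightarrow>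
     (let L = localization R (powers_of R u); \<iota> = to_localization R (powers_of R u) in
      \<forall>t\<in>T. x t 0 = \<iota> t \<and>
        (\<forall>i. x t i \<in> integral_preimage R S h u \<and> q t i \<in> Q \<and>
           \<iota> u \<otimes>\<^bsub>L\<^esub> x t (Suc i) = x t i \<ominus>\<^bsub>L\<^esub> \<iota> (q t i)))"

end

theory Submission
  imports Defs
begin

text \<open>
  Every \<open>x \<in> \<phi>\<inverse>S\<close> has a unique leading digit \<open>q \<in> Q\<close> with \<open>x - q \<in> u \<cdot> \<phi>\<inverse>S\<close>,
  because \<open>\<phi>\<inverse>S / u \<cdot> \<phi>\<inverse>S\<close>, \<open>S/(v)\<close> and \<open>R/I\<close> coincide;
  that \<open>\<phi>\<inverse>S / u \<cdot> \<phi>\<inverse>S \<rightarrow> S/(v)\<close> is well defined uses that the elements of \<open>S\<close> killed by a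
  power of \<open>v\<close> lie in \<open>(v)\<close>.
  Let \<open>G\<close> be the ring generated by \<open>Q\<close> and the \<open>t\<^sub>i\<close>. The generators lie in \<open>R + uG\<close>,
  hence \<open>G = R + uG\<close>, while \<open>I \<subseteq> uG\<close> because \<open>t - q(t) = u t\<^sub>1\<close>. An element
  \<open>r + ug\<close> of \<open>G \<inter> u \<cdot> \<phi>\<inverse>S\<close> has \<open>r \<in> I\<close>, so \<open>G \<inter> u \<cdot> \<phi>\<inverse>S = uG\<close>. Since every element of
  \<open>\<phi>\<inverse>S\<close> is carried into \<open>R \<subseteq> G\<close> by a power of \<open>u\<close>, cancelling one factor \<open>u\<close> at a time
  yields \<open>\<phi>\<inverse>S = G\<close>.
\<close>

section \<open>Preimages of subrings and of multiples of an element\<close>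

lemma (in ring_hom_ring) subring_preimage:
  assumes "subring K S"
  shows "subring {x \<in> carrier R. h x \<in> K} R"
  using subringE[OF assms] by (intro R.subringI) auto

text \<open>The products \<open>c \<otimes> g\<close> with \<open>g \<in> G\<close> form an ideal of
  \<open>G\<close>, and \<open>f\<close> maps \<open>A\<close> into \<open>G\<close>. With
  \<open>c\<close> the image of \<open>u\<close>, this reduces the inclusion of \<open>I\<close> in
  \<open>uG\<close> to the generators of \<open>I\<close>.\<close>

lemma (in cring) ideal_preimage_subring_multiples:
  assumes "ring_hom_cring A R f" and "subring G R" and "f ` carrier A \<subseteq> G" and "c \<in> carrier R"
  shows "ideal {a \<in> carrier A. \<exists>g\<in>G. f a = c \<otimes> g} A"
proof -
  interpret f: ring_hom_cring A R f by fact
  note G = subringE[OF assms(2)]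
  note sub = subsetD[OF G(1)]
  have mult: "\<exists>g\<in>G. f (x \<otimes>\<^bsub>A\<^esub> a) = c \<otimes> g"
    if "a \<in> carrier A" "x \<in> carrier A" "g \<in> G" "f a = c \<otimes> g" for a x g
  proof -
    have "f x \<in> G" using that assms(3) by auto
    then show ?thesis
      using that sub assms(4) G(6) by (intro bexI[of _ "f x \<otimes> g"]) (auto simp: m_lcomm)
  qed
  show ?thesis
  proof (rule idealI)
    show "subgroup {a \<in> carrier A. \<exists>g\<in>G. f a = c \<otimes> g} (add_monoid A)"
    proof (rule f.R.add.subgroupI)
      have "f \<zero>\<^bsub>A\<^esub> = c \<otimes> \<zero>" using assms(4) by simp
      then show "{a \<in> carrier A. \<exists>g\<in>G. f a = c \<otimes> g} \<noteq> {}" using G(2) by blast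
    next
      fix a assume "a \<in> {a \<in> carrier A. \<exists>g\<in>G. f a = c \<otimes> g}"
      then obtain g where "a \<in> carrier A" "g \<in> G" "f a = c \<otimes> g" by blast
      then show "\<ominus>\<^bsub>A\<^esub> a \<in> {a \<in> carrier A. \<exists>g\<in>G. f a = c \<otimes> g}"
        using sub assms(4) G(5) by (auto simp: r_minus intro!: bexI[of _ "\<ominus> g"])
    next
      fix a b assume "a \<in> {a \<in> carrier A. \<exists>g\<in>G. f a = c \<otimes> g}" "b \<in> {a \<in> carrier A. \<exists>g\<in>G. f a = c \<otimes> g}"
      then obtain g g' where "a \<in> carrier A" "g \<in> G" "f a = c \<otimes> g" "b \<in> carrier A" "g' \<in> G" "f b = c \<otimes> g'"
        by blast
      then show "a \<oplus>\<^bsub>A\<^esub> b \<in> {a \<in> carrier A. \<exists>g\<in>G. f a = c \<otimes> g}"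
        using sub assms(4) G(7) by (auto simp: r_distr intro!: bexI[of _ "g \<oplus> g'"])
    qed auto
  qed (use mult in \<open>auto simp: f.R.ring_axioms f.R.m_comm\<close>)
qed

section \<open>The canonical map into a localization\<close>

lemma (in cring) to_localization_hom:
  assumes "submonoid M R"
  shows "to_localization R M \<in> ring_hom R (localization R M)"
proof -
  interpret M: submonoid M R by fact
  show ?thesis
    by (rule ring_hom_memI)
      (simp_all add: to_localization_def frac_closed localization_mult[OF assms]
        localization_add[OF assms], simp add: localization_def)
qed

lemma (in cring) to_localization_unit:
  assumes M: "submonoid M R" and "s \<in> M"
  shows "to_localization R M s \<in> Units (localization R M)"
    and "a \<in> carrier R \<Longrightarrow>
      to_localization R M s \<otimes>\<^bsub>localization R M\<^esub> fraction R M a s = to_localization R M a"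
proof -
  interpret M: submonoid M R by fact
  interpret L: cring "localization R M" using M by (rule localization_cring)
  have car: "s \<in> carrier R" using assms M.subset by auto
  \<comment> \<open>Proved first because its case \<open>a = \<one>\<close> exhibits the inverse of
    the image of \<open>s\<close>.\<close>
  show cancel: "to_localization R M s \<otimes>\<^bsub>localization R M\<^esub> fraction R M a s = to_localization R M a"
    if "a \<in> carrier R" for a
    using that car assms
    by (auto simp: to_localization_def localization_mult[OF M] frac_eq_iff[OF M]
        intro!: bexI[OF _ M.one_closed])
  show "to_localization R M s \<in> Units (localization R M)"
    using cancel[OF one_closed] car assms ring_hom_one[OF to_localization_hom[OF M]]
      ring_hom_closed[OF to_localization_hom[OF M] car]
    by (auto simp: Units_def L.m_comm frac_closed intro!: bexI[of _ "fraction R M \<one> s"])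
qed

section \<open>Digit expansions in an abstract ring \<open>P\<close> between \<open>R\<close> and
  \<open>L\<close>\<close>

text \<open>\<open>P\<close> stands for \<phi>\<inverse>S, with \<open>S\<close> and
  \<open>h\<close> eliminated. \<open>contraction\<close> says that R/I \<rightarrow> P/uP is well
  defined and injective; \<open>leading_digit\<close> says that it is onto, with preimages already
  taken in \<open>Q\<close>.\<close>

locale digit_expansion = ring_hom_cring R L \<iota>
  for R (structure) and L (structure) and \<iota> +
  fixes u and I Q P
  assumes base: "u \<in> carrier R" "\<iota> u \<in> Units L"
    and subring: "subring P L"
    and image: "\<iota> ` carrier R \<subseteq> P"
    and digits: "Q \<subseteq> carrier R"
    and digits_inj: "\<lbrakk>q \<in> Q; q' \<in> Q; q \<ominus> q' \<in> I\<rbrakk> \<Longrightarrow> q = q'"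
    and contraction: "r \<in> carrier R \<Longrightarrow> r \<in> I \<longleftrightarrow> (\<exists>y\<in>P. \<iota> r = \<iota> u \<otimes>\<^bsub>L\<^esub> y)"
    and leading_digit: "x \<in> P \<Longrightarrow> \<exists>q\<in>Q. \<exists>y\<in>P. \<iota> u \<otimes>\<^bsub>L\<^esub> y = x \<ominus>\<^bsub>L\<^esub> \<iota> q"
    and denominator: "x \<in> P \<Longrightarrow> \<exists>n. \<iota> u [^]\<^bsub>L\<^esub> (n::nat) \<otimes>\<^bsub>L\<^esub> x \<in> \<iota> ` carrier R"
begin

lemmas P_closed = subsetD[OF subringE(1)[OF subring]]

text \<open>Subtracting the two equations shows that the image of \<open>q \<ominus> q'\<close> is
  \<open>u\<close> times an element of \<open>P\<close>, so \<open>contraction\<close> and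
  \<open>digits_inj\<close> give equal digits. Then the unit \<open>\<iota> u\<close>
  cancels.\<close>

lemma leading_digit_unique:
  assumes "q \<in> Q" "q' \<in> Q" "y \<in> P" "y' \<in> P" "x \<in> P"
    and e: "\<iota> u \<otimes>\<^bsub>L\<^esub> y = x \<ominus>\<^bsub>L\<^esub> \<iota> q" "\<iota> u \<otimes>\<^bsub>L\<^esub> y' = x \<ominus>\<^bsub>L\<^esub> \<iota> q'"
  shows "q = q'" and "y = y'"
proof -
  have R: "q \<in> carrier R" "q' \<in> carrier R" using assms digits by auto
  note car = R assms(3-5)[THEN P_closed] base(1)
  have y: "y' \<ominus>\<^bsub>L\<^esub> y \<in> P"
    using assms(3,4) subringE(5,7)[OF subring] by (simp add: S.minus_eq)
  have "\<iota> (q \<ominus> q') = (x \<ominus>\<^bsub>L\<^esub> \<iota> q') \<ominus>\<^bsub>L\<^esub> (x \<ominus>\<^bsub>L\<^esub> \<iota> q)"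
    using car by (simp add: R.minus_eq S.minus_eq S.minus_add S.a_ac S.r_neg1 S.r_neg2)
  also have "\<dots> = \<iota> u \<otimes>\<^bsub>L\<^esub> (y' \<ominus>\<^bsub>L\<^esub> y)"
    unfolding e[symmetric] using car by (simp add: S.minus_eq S.r_distr S.r_minus)
  finally have "q \<ominus> q' \<in> I" using contraction y R by blast
  then show "q = q'" using assms digits_inj by blast
  then have "\<iota> u \<otimes>\<^bsub>L\<^esub> y = \<iota> u \<otimes>\<^bsub>L\<^esub> y'" using e by simp
  then show "y = y'" using car base(2) S.Units_l_cancel by blast
qed

text \<open>Removing a leading digit and dividing by \<open>\<iota> u\<close> maps \<open>P\<close>
  to itself, so a fixed choice of digit \<open>d\<close> and quotient \<open>f\<close> can be
  iterated from \<open>x\<close>.\<close>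

lemma expansion_exists:
  assumes "x \<in> P"
  shows "\<exists>y q. y 0 = x \<and>
    (\<forall>i::nat. y i \<in> P \<and> q i \<in> Q \<and> \<iota> u \<otimes>\<^bsub>L\<^esub> y (Suc i) = y i \<ominus>\<^bsub>L\<^esub> \<iota> (q i))"
proof -
  obtain d where d: "\<And>x. x \<in> P \<Longrightarrow> d x \<in> Q \<and> (\<exists>y\<in>P. \<iota> u \<otimes>\<^bsub>L\<^esub> y = x \<ominus>\<^bsub>L\<^esub> \<iota> (d x))"
    using leading_digit by metis
  then obtain f where f: "\<And>x. x \<in> P \<Longrightarrow> f x \<in> P \<and> \<iota> u \<otimes>\<^bsub>L\<^esub> f x = x \<ominus>\<^bsub>L\<^esub> \<iota> (d x)"
    by metis
  have mem: "(f ^^ i) x \<in> P" for i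
    using assms f by (induction i) auto
  show ?thesis
    using mem f d by (intro exI[of _ "\<lambda>i. (f ^^ i) x"] exI[of _ "\<lambda>i. d ((f ^^ i) x)"]) simp
qed

lemma expansion_unique:
  assumes "y 0 = y' 0"
    and y: "\<forall>i::nat. y i \<in> P \<and> q i \<in> Q \<and> \<iota> u \<otimes>\<^bsub>L\<^esub> y (Suc i) = y i \<ominus>\<^bsub>L\<^esub> \<iota> (q i)"
    and y': "\<forall>i::nat. y' i \<in> P \<and> q' i \<in> Q \<and> \<iota> u \<otimes>\<^bsub>L\<^esub> y' (Suc i) = y' i \<ominus>\<^bsub>L\<^esub> \<iota> (q' i)"
  shows "y i = y' i" and "q i = q' i"
proof -
  \<comment> \<open>The element at index \<open>i\<close> determines both its digit and the next
    element, so the induction needs to carry only the elements.\<close>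
  have step: "q i = q' i \<and> y (Suc i) = y' (Suc i)" if "y i = y' i" for i
    using leading_digit_unique[of "q i" "q' i" "y (Suc i)" "y' (Suc i)" "y i"] y y' that by metis
  show "y i = y' i"
    by (induction i) (use assms(1) step in auto)
  then show "q i = q' i" using step by blast
qed

lemma generated_ring_eq:
  assumes "T \<subseteq> carrier R" and gen: "generate_ring R (T \<union> Q) = carrier R"
    and rep: "\<forall>t\<in>T. rep t \<in> Q" and I: "Idl {t \<ominus> rep t | t. t \<in> T} = I"
    and x0: "\<forall>t\<in>T. x t 0 = \<iota> t"
    and x: "\<forall>t\<in>T. \<forall>i::nat. x t i \<in> P \<and> q t i \<in> Q \<and> \<iota> u \<otimes>\<^bsub>L\<^esub> x t (Suc i) = x t i \<ominus>\<^bsub>L\<^esub> \<iota> (q t i)"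
  shows "generate_ring L (\<iota> ` Q \<union> {x t i | t i. t \<in> T}) = P"
proof -
  define X where "X = \<iota> ` Q \<union> {x t i | t i. t \<in> T}"
  define G where "G = generate_ring L X"
  have XP: "X \<subseteq> P"
    unfolding X_def using x image digits by blast
  then have XL: "X \<subseteq> carrier L" using P_closed by auto
  have Gsub: "subring G L" unfolding G_def using XL by (rule S.generate_ring_is_subring)
  note G = subringE[OF Gsub]
  note GL = subsetD[OF G(1)]
  have GP: "G \<subseteq> P"
    unfolding G_def using XL subring XP by (rule S.generate_ring_min_subring1)
  have XG: "X \<subseteq> G" by (auto simp: G_def intro: generate_ring.incl)
  have u: "\<iota> u \<in> carrier L" using base by simp
  \<comment> \<open>The preimage of \<open>G\<close> in \<open>R\<close> is a subring containing
    \<open>Q\<close> and also \<open>T\<close>, whose elements occur in \<open>X\<close> at index 0.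
    Together these generate \<open>R\<close>.\<close>
  have RG: "\<iota> r \<in> G" if "r \<in> carrier R" for r
  proof -
    have "T \<union> Q \<subseteq> {r \<in> carrier R. \<iota> r \<in> G}"
    proof
      fix r assume "r \<in> T \<union> Q"
      moreover have "\<iota> r \<in> X" if "r \<in> T"
      proof -
        have "\<iota> r = x r 0" using that x0 by simp
        then show ?thesis unfolding X_def using that by blast
      qed
      moreover have "\<iota> r \<in> X" if "r \<in> Q" using that by (simp add: X_def)
      ultimately show "r \<in> {r \<in> carrier R. \<iota> r \<in> G}"
        using XG assms(1) digits by auto
    qed
    then have "generate_ring R (T \<union> Q) \<subseteq> {r \<in> carrier R. \<iota> r \<in> G}"
      using ring.subring_preimage[OF Gsub] by (intro R.generate_ring_min_subring1) auto
    then show ?thesis using that gen by blast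
  qed
  \<comment> \<open>Induction over the generation of \<open>G\<close>. A digit needs no multiple of
    \<open>u\<close>; for \<open>x t i\<close> the recurrence supplies the digit
    \<open>q t i\<close> and the multiplier \<open>x t (Suc i)\<close>, itself a generator.\<close>
  have decomp: "\<exists>r\<in>carrier R. \<exists>g'\<in>G. g = \<iota> r \<oplus>\<^bsub>L\<^esub> \<iota> u \<otimes>\<^bsub>L\<^esub> g'" if "g \<in> G" for g
    using that unfolding G_def
  proof (induction rule: generate_ring.induct)
    case one
    then show ?case
      using G(2) u by (intro bexI[of _ \<one>] bexI[of _ "\<zero>\<^bsub>L\<^esub>"]) (auto simp: G_def)
  next
    case (incl g)
    then consider r where "r \<in> Q" "g = \<iota> r" | t i where "t \<in> T" "g = x t i"
      unfolding X_def by blast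
    then show ?case
    proof cases
      case 1
      then show ?thesis
        using G(2) u digits by (intro bexI[of _ r] bexI[of _ "\<zero>\<^bsub>L\<^esub>"]) (auto simp: G_def)
    next
      case 2
      have "x t i \<in> carrier L" "q t i \<in> carrier R" using 2 x P_closed digits by auto
      then have "g = \<iota> (q t i) \<oplus>\<^bsub>L\<^esub> (x t i \<ominus>\<^bsub>L\<^esub> \<iota> (q t i))"
        using 2 by (simp add: S.minus_eq S.a_lcomm S.r_neg)
      moreover have "x t (Suc i) \<in> G" using 2(1) XG unfolding X_def by blast
      ultimately show ?thesis
        using 2 x \<open>q t i \<in> carrier R\<close> unfolding G_def by metis
    qed
  next
    case (a_inv g)
    then obtain r g' where g: "r \<in> carrier R" "g' \<in> G" "g = \<iota> r \<oplus>\<^bsub>L\<^esub> \<iota> u \<otimes>\<^bsub>L\<^esub> g'"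
      unfolding G_def by blast
    then have "\<ominus>\<^bsub>L\<^esub> g = \<iota> (\<ominus> r) \<oplus>\<^bsub>L\<^esub> \<iota> u \<otimes>\<^bsub>L\<^esub> (\<ominus>\<^bsub>L\<^esub> g')"
      using GL u by (simp add: S.minus_add S.r_minus)
    then show ?case using g G(5) unfolding G_def by blast
  next
    case (eng_add g1 g2)
    then obtain r1 g1' r2 g2' where g: "r1 \<in> carrier R" "g1' \<in> G" "g1 = \<iota> r1 \<oplus>\<^bsub>L\<^esub> \<iota> u \<otimes>\<^bsub>L\<^esub> g1'"
      "r2 \<in> carrier R" "g2' \<in> G" "g2 = \<iota> r2 \<oplus>\<^bsub>L\<^esub> \<iota> u \<otimes>\<^bsub>L\<^esub> g2'"
      unfolding G_def by blast
    then have "g1 \<oplus>\<^bsub>L\<^esub> g2 = \<iota> (r1 \<oplus> r2) \<oplus>\<^bsub>L\<^esub> \<iota> u \<otimes>\<^bsub>L\<^esub> (g1' \<oplus>\<^bsub>L\<^esub> g2')"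
      using GL u by (simp add: S.r_distr S.a_ac)
    then show ?case using g G(7) R.add.m_closed unfolding G_def by blast
  next
    case (eng_mult g1 g2)
    then obtain r1 g1' r2 g2' where g: "r1 \<in> carrier R" "g1' \<in> G" "g1 = \<iota> r1 \<oplus>\<^bsub>L\<^esub> \<iota> u \<otimes>\<^bsub>L\<^esub> g1'"
      "r2 \<in> carrier R" "g2' \<in> G" "g2 = \<iota> r2 \<oplus>\<^bsub>L\<^esub> \<iota> u \<otimes>\<^bsub>L\<^esub> g2'"
      unfolding G_def by blast
    \<comment> \<open>Only the first factor is expanded against all of \<open>g2\<close>; then
      \<open>g2\<close> is expanded only next to \<open>\<iota> r1\<close>. This collects everything
      beyond \<open>r1 \<otimes> r2\<close> under a single factor \<open>u\<close>, and
      \<open>RG\<close> keeps the multiplier in \<open>G\<close>.\<close>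
    let ?g = "\<iota> r1 \<otimes>\<^bsub>L\<^esub> g2' \<oplus>\<^bsub>L\<^esub> g1' \<otimes>\<^bsub>L\<^esub> g2"
    have mem: "?g \<in> G" "g2 \<in> G" using g G(6,7) RG eng_mult by (auto simp: G_def)
    have "g1 \<otimes>\<^bsub>L\<^esub> g2 = \<iota> r1 \<otimes>\<^bsub>L\<^esub> g2 \<oplus>\<^bsub>L\<^esub> \<iota> u \<otimes>\<^bsub>L\<^esub> (g1' \<otimes>\<^bsub>L\<^esub> g2)"
      using g(1,2) mem(2)[THEN GL] GL u unfolding g(3) by (simp add: S.l_distr S.m_assoc)
    also have "\<dots> = \<iota> (r1 \<otimes> r2) \<oplus>\<^bsub>L\<^esub> \<iota> u \<otimes>\<^bsub>L\<^esub> (\<iota> r1 \<otimes>\<^bsub>L\<^esub> g2') \<oplus>\<^bsub>L\<^esub> \<iota> u \<otimes>\<^bsub>L\<^esub> (g1' \<otimes>\<^bsub>L\<^esub> g2)"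
      using g(1,2,4,5) GL u by (subst g(6)) (simp add: S.r_distr S.m_lcomm)
    also have "\<dots> = \<iota> (r1 \<otimes> r2) \<oplus>\<^bsub>L\<^esub> \<iota> u \<otimes>\<^bsub>L\<^esub> ?g"
      using g(1,2,4,5) mem(2)[THEN GL] GL u by (simp add: S.r_distr S.a_assoc)
    finally show ?case using g mem R.m_closed unfolding G_def by blast
  qed
  have IG: "\<exists>g\<in>G. \<iota> r = \<iota> u \<otimes>\<^bsub>L\<^esub> g" if "r \<in> I" for r
  proof -
    have "{t \<ominus> rep t | t. t \<in> T} \<subseteq> {r \<in> carrier R. \<exists>g\<in>G. \<iota> r = \<iota> u \<otimes>\<^bsub>L\<^esub> g}"
    proof clarify
      fix t assume t: "t \<in> T"
      have car: "t \<in> carrier R" "rep t \<in> carrier R" "rep t \<in> Q" using t assms(1) rep digits by auto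
      have "{t \<ominus> rep t | t. t \<in> T} \<subseteq> carrier R"
        using assms(1) rep digits by auto
      then have "t \<ominus> rep t \<in> I" using t R.genideal_self I by blast
      \<comment> \<open>\<open>contraction\<close> gives a quotient in \<open>P\<close> only; its
        membership in \<open>G\<close> comes from the uniqueness below.\<close>
      then obtain y where y: "y \<in> P" "\<iota> (t \<ominus> rep t) = \<iota> u \<otimes>\<^bsub>L\<^esub> y"
        using contraction[of "t \<ominus> rep t"] car by auto
      moreover have hom: "\<iota> (t \<ominus> rep t) = x t 0 \<ominus>\<^bsub>L\<^esub> \<iota> (rep t)"
        using t x0 car by (simp add: R.minus_eq S.minus_eq)
      \<comment> \<open>Both \<open>rep t\<close> with \<open>y\<close> and \<open>q t 0\<close>
        with \<open>x t (Suc 0)\<close> split off a leading digit of \<open>x t 0\<close>, so the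
        quotients agree.\<close>
      ultimately have "y = x t (Suc 0)"
        using leading_digit_unique(2)[of "rep t" "q t 0" y "x t (Suc 0)" "x t 0"] car x t by auto
      then have "y \<in> G" using t XG unfolding X_def by blast
      with y show "t \<ominus> rep t \<in> carrier R \<and> (\<exists>g\<in>G. \<iota> (t \<ominus> rep t) = \<iota> u \<otimes>\<^bsub>L\<^esub> g)"
        using car by auto
    qed
    moreover have "ideal {r \<in> carrier R. \<exists>g\<in>G. \<iota> r = \<iota> u \<otimes>\<^bsub>L\<^esub> g} R"
      using ring_hom_cring_axioms Gsub RG u by (intro S.ideal_preimage_subring_multiples) auto
    ultimately have "I \<subseteq> {r \<in> carrier R. \<exists>g\<in>G. \<iota> r = \<iota> u \<otimes>\<^bsub>L\<^esub> g}"
      using R.genideal_minimal I by blast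
    then show ?thesis using that by blast
  qed
  have cancel: "y \<in> G" if y: "y \<in> P" "\<iota> u \<otimes>\<^bsub>L\<^esub> y \<in> G" for y
  proof -
    obtain r g where g: "r \<in> carrier R" "g \<in> G" "\<iota> u \<otimes>\<^bsub>L\<^esub> y = \<iota> r \<oplus>\<^bsub>L\<^esub> \<iota> u \<otimes>\<^bsub>L\<^esub> g"
      using decomp y by blast
    note car = g(1) GL[OF g(2)] P_closed[OF y(1)] u
    \<comment> \<open>Isolating \<open>r\<close> exhibits it as \<open>u\<close> times
      \<open>y \<ominus> g\<close>, which lies in \<open>P\<close> although \<open>y\<close> is not
      yet known to lie in \<open>G\<close>. Hence \<open>r \<in> I\<close>, and \<open>IG\<close>
      provides a quotient in \<open>G\<close>.\<close>
    have "\<iota> r = (\<iota> r \<oplus>\<^bsub>L\<^esub> \<iota> u \<otimes>\<^bsub>L\<^esub> g) \<ominus>\<^bsub>L\<^esub> \<iota> u \<otimes>\<^bsub>L\<^esub> g"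
      using car by (simp add: S.minus_eq S.a_assoc S.r_neg)
    also have "\<dots> = \<iota> u \<otimes>\<^bsub>L\<^esub> (y \<ominus>\<^bsub>L\<^esub> g)"
      unfolding g(3)[symmetric] using car by (simp add: S.minus_eq S.r_distr S.r_minus)
    moreover have "y \<ominus>\<^bsub>L\<^esub> g \<in> P"
      using g(2) GP y(1) subringE(5,7)[OF subring] by (auto simp: S.minus_eq)
    ultimately have "r \<in> I" using contraction g(1) by auto
    then obtain g' where g': "g' \<in> G" "\<iota> r = \<iota> u \<otimes>\<^bsub>L\<^esub> g'" using IG by blast
    then have "\<iota> u \<otimes>\<^bsub>L\<^esub> y = \<iota> u \<otimes>\<^bsub>L\<^esub> (g' \<oplus>\<^bsub>L\<^esub> g)"
      using g(3) car GL by (simp add: S.r_distr)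
    then have "y = g' \<oplus>\<^bsub>L\<^esub> g"
      using base(2) car GL[OF g'(1)] by (subst (asm) S.Units_l_cancel) auto
    then show ?thesis using g g' G(7) by simp
  qed
  \<comment> \<open>The induction generalizes over \<open>y\<close>: one factor of the power is
    absorbed into \<open>y\<close>, the hypothesis puts \<open>u\<close> times \<open>y\<close> into
    \<open>G\<close>, and \<open>cancel\<close> removes that factor.\<close>
  have clear: "y \<in> G" if "y \<in> P" "\<iota> u [^]\<^bsub>L\<^esub> (n::nat) \<otimes>\<^bsub>L\<^esub> y \<in> G" for n y
    using that
  proof (induction n arbitrary: y)
    case 0
    then show ?case using P_closed by simp
  next
    case (Suc n)
    have "\<iota> u \<otimes>\<^bsub>L\<^esub> y \<in> P"
      using Suc.prems(1) base(1) image subringE(6)[OF subring] by auto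
    moreover have "\<iota> u [^]\<^bsub>L\<^esub> n \<otimes>\<^bsub>L\<^esub> (\<iota> u \<otimes>\<^bsub>L\<^esub> y) \<in> G"
      using Suc.prems(2) u P_closed[OF Suc.prems(1)] by (simp add: S.m_assoc)
    ultimately show ?case using Suc cancel by blast
  qed
  have "P \<subseteq> G"
  proof
    fix y assume y: "y \<in> P"
    then obtain n where "\<iota> u [^]\<^bsub>L\<^esub> (n::nat) \<otimes>\<^bsub>L\<^esub> y \<in> \<iota> ` carrier R" using denominator by blast
    then have "\<iota> u [^]\<^bsub>L\<^esub> n \<otimes>\<^bsub>L\<^esub> y \<in> G" using RG by auto
    with y show "y \<in> G" by (rule clear)
  qed
  then have "G = P" using GP by (intro equalityI)
  then show ?thesis unfolding G_def X_def .
qed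

end

section \<open>The preimage of \<open>S\<close> under an induced map of localizations\<close>

text \<open>The properties of the two localizations that the argument draws on:
  \<open>denominator\<close> presents \<open>L\<close> as fractions over \<open>R\<close> with
  powers of \<open>u\<close> below, and \<open>torsion\<close> says that elements of
  \<open>S\<close> merge in \<open>L'\<close> only if a power of \<open>h u\<close> already
  identifies them.\<close>

locale localized_hom =
  h: ring_hom_cring R S h + \<iota>: ring_hom_cring R L \<iota> + \<iota>': ring_hom_cring S L' \<iota>' +
  \<phi>: ring_hom_cring L L' \<phi>
  for R (structure) and S (structure) and L (structure) and L' (structure) and h \<iota> \<iota>' \<phi> +
  fixes u
  assumes u: "u \<in> carrier R"
    and units: "\<iota> u \<in> Units L" "\<iota>' (h u) \<in> Units L'"
    and commute: "r \<in> carrier R \<Longrightarrow> \<phi> (\<iota> r) = \<iota>' (h r)"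
    and denominator: "x \<in> carrier L \<Longrightarrow> \<exists>n. \<iota> u [^]\<^bsub>L\<^esub> (n::nat) \<otimes>\<^bsub>L\<^esub> x \<in> \<iota> ` carrier R"
    and torsion: "\<lbrakk>s \<in> carrier S; s' \<in> carrier S; \<iota>' s = \<iota>' s'\<rbrakk> \<Longrightarrow>
      \<exists>n. h u [^]\<^bsub>S\<^esub> (n::nat) \<otimes>\<^bsub>S\<^esub> s = h u [^]\<^bsub>S\<^esub> n \<otimes>\<^bsub>S\<^esub> s'"
begin

definition preimage where "preimage = {x \<in> carrier L. \<phi> x \<in> \<iota>' ` carrier S}"

text \<open>If \<open>s\<close> is \<open>s'\<close> times \<open>h u\<close>, cancelling the unit
  \<open>\<iota>' (h u)\<close> shows that \<phi> sends the quotient of \<open>x\<close> by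
  \<open>\<iota> u\<close> to \<open>\<iota>' s'\<close>. Such quotients are the next elements of
  expansions.\<close>

lemma divide:
  assumes x: "x \<in> carrier L" "s \<in> PIdl\<^bsub>S\<^esub> (h u)" "\<phi> x = \<iota>' s"
  shows "\<exists>y\<in>preimage. \<iota> u \<otimes>\<^bsub>L\<^esub> y = x"
proof -
  obtain s' where s': "s' \<in> carrier S" "s = s' \<otimes>\<^bsub>S\<^esub> h u"
    using x(2) unfolding cgenideal_def by blast
  define y where "y = inv\<^bsub>L\<^esub> (\<iota> u) \<otimes>\<^bsub>L\<^esub> x"
  have y: "y \<in> carrier L" "\<iota> u \<otimes>\<^bsub>L\<^esub> y = x"
    using units(1) x(1) u by (simp_all add: y_def \<iota>.S.m_assoc[symmetric])
  have "\<iota>' (h u) \<otimes>\<^bsub>L'\<^esub> \<phi> y = \<phi> (\<iota> u \<otimes>\<^bsub>L\<^esub> y)"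
    using y(1) u commute by simp
  also have "\<dots> = \<iota>' (h u) \<otimes>\<^bsub>L'\<^esub> \<iota>' s'"
    unfolding y(2) x(3) s'(2) using s' u by (simp add: \<iota>'.S.m_comm)
  finally have "\<phi> y = \<iota>' s'"
    using units(2) y(1) s'(1) by (simp add: \<iota>'.S.Units_l_cancel)
  then show ?thesis using y s'(1) unfolding preimage_def by blast
qed

lemma image_subset_preimage: "\<iota> ` carrier R \<subseteq> preimage"
  using commute unfolding preimage_def by auto

text \<open>If \<open>\<phi> y\<close> comes from \<open>s\<close>, then \<open>h r\<close> and
  \<open>h u\<close> times \<open>s\<close> agree in \<open>L'\<close>, so a power of
  \<open>h u\<close> kills their difference. By \<open>tors\<close> that difference lies in the
  ideal of \<open>h u\<close>, and hence so does \<open>h r\<close>.\<close>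

lemma contraction:
  assumes tors: "\<And>s n. \<lbrakk>s \<in> carrier S; (h u [^]\<^bsub>S\<^esub> (n::nat)) \<otimes>\<^bsub>S\<^esub> s = \<zero>\<^bsub>S\<^esub>\<rbrakk> \<Longrightarrow> s \<in> PIdl\<^bsub>S\<^esub> (h u)"
    and r: "r \<in> carrier R" "y \<in> preimage" "\<iota> r = \<iota> u \<otimes>\<^bsub>L\<^esub> y"
  shows "h r \<in> PIdl\<^bsub>S\<^esub> (h u)"
proof -
  interpret V: ideal "PIdl\<^bsub>S\<^esub> (h u)" S using u by (intro h.S.cgenideal_ideal) simp
  obtain s where s: "s \<in> carrier S" "\<phi> y = \<iota>' s" and y: "y \<in> carrier L"
    using r(2) unfolding preimage_def by blast
  let ?vs = "h u \<otimes>\<^bsub>S\<^esub> s"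
  have vs: "?vs \<in> PIdl\<^bsub>S\<^esub> (h u)" "?vs \<in> carrier S" "h r \<in> carrier S" "h u \<in> carrier S"
    using u s(1) r(1) by (auto intro!: V.I_r_closed h.S.cgenideal_self)
  have "\<iota>' (h r) = \<phi> (\<iota> u \<otimes>\<^bsub>L\<^esub> y)" using commute[OF r(1)] r(3) by simp
  also have "\<dots> = \<iota>' ?vs" using y s u commute by simp
  finally obtain n where n: "h u [^]\<^bsub>S\<^esub> (n::nat) \<otimes>\<^bsub>S\<^esub> h r = h u [^]\<^bsub>S\<^esub> n \<otimes>\<^bsub>S\<^esub> ?vs"
    using torsion vs by blast
  have "h u [^]\<^bsub>S\<^esub> n \<otimes>\<^bsub>S\<^esub> (h r \<ominus>\<^bsub>S\<^esub> ?vs) =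
      h u [^]\<^bsub>S\<^esub> n \<otimes>\<^bsub>S\<^esub> h r \<oplus>\<^bsub>S\<^esub> \<ominus>\<^bsub>S\<^esub> (h u [^]\<^bsub>S\<^esub> n \<otimes>\<^bsub>S\<^esub> ?vs)"
    using vs(2-4) by (simp add: h.S.minus_eq h.S.r_distr h.S.r_minus)
  also have "\<dots> = \<zero>\<^bsub>S\<^esub>"
    unfolding n using vs(2-4) by (simp add: h.S.r_neg)
  finally have "h r \<ominus>\<^bsub>S\<^esub> ?vs \<in> PIdl\<^bsub>S\<^esub> (h u)"
    using tors vs(2,3) by simp
  then have "(h r \<ominus>\<^bsub>S\<^esub> ?vs) \<oplus>\<^bsub>S\<^esub> ?vs \<in> PIdl\<^bsub>S\<^esub> (h u)"
    using vs(1) by (rule V.a_closed)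
  then show ?thesis
    using vs(2,3) by (simp add: h.S.minus_eq h.S.a_assoc h.S.l_neg)
qed

lemma digit_expansion:
  assumes tors: "\<And>s n. \<lbrakk>s \<in> carrier S; (h u [^]\<^bsub>S\<^esub> (n::nat)) \<otimes>\<^bsub>S\<^esub> s = \<zero>\<^bsub>S\<^esub>\<rbrakk> \<Longrightarrow> s \<in> PIdl\<^bsub>S\<^esub> (h u)"
    and I: "I = a_kernel R (S Quot (PIdl\<^bsub>S\<^esub> (h u))) (residue_map S h (h u))"
    and Q: "coset_representatives R I Q"
    and onto: "residue_map S h (h u) ` carrier R = carrier (S Quot (PIdl\<^bsub>S\<^esub> (h u)))"
  shows "digit_expansion R L \<iota> u I Q preimage"
proof -
  interpret V: ideal "PIdl\<^bsub>S\<^esub> (h u)" S using u by (intro h.S.cgenideal_ideal) simp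
  \<comment> \<open>The zero of the quotient ring is the coset \<open>PIdl (h u)\<close> itself, so
    \<open>I\<close> is the preimage of this ideal under \<open>h\<close>.\<close>
  have I_iff: "r \<in> I \<longleftrightarrow> r \<in> carrier R \<and> h r \<in> PIdl\<^bsub>S\<^esub> (h u)" for r
  proof -
    have "PIdl\<^bsub>S\<^esub> (h u) +>\<^bsub>S\<^esub> h r = PIdl\<^bsub>S\<^esub> (h u) \<longleftrightarrow> h r \<in> PIdl\<^bsub>S\<^esub> (h u)" if "r \<in> carrier R"
      using V.a_rcos_const V.a_rcos_self[of "h r"] that by auto
    moreover have "r \<in> I \<longleftrightarrow> r \<in> carrier R \<and> PIdl\<^bsub>S\<^esub> (h u) +>\<^bsub>S\<^esub> h r = PIdl\<^bsub>S\<^esub> (h u)"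
      unfolding I a_kernel_def' residue_map_def by (simp add: FactRing_def)
    ultimately show ?thesis by blast
  qed
  have Qsub: "Q \<subseteq> carrier R" using Q by (simp add: coset_representatives_def)
  interpret I: ideal I R
  proof -
    have "I = {r \<in> carrier R. h r \<in> PIdl\<^bsub>S\<^esub> (h u)}" using I_iff by blast
    then show "ideal I R" using h.ring.ideal_vimage[OF V.ideal_axioms] by simp
  qed
  note I_cong = h.R.quotient_eq_iff_same_a_r_cos[OF I.ideal_axioms]
  have ex1: "\<exists>!q. q \<in> Q \<and> q \<in> I +> r" if "r \<in> carrier R" for r
    using Q that unfolding coset_representatives_def A_RCOSETS_def' by blast
  have digits_inj: "q = q'" if "q \<in> Q" "q' \<in> Q" "q \<ominus> q' \<in> I" for q q'
  proof -
    have car: "q \<in> carrier R" "q' \<in> carrier R" using that Qsub by auto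
    then have "I +> q = I +> q'" using I_cong that(3) by blast
    then show ?thesis using ex1[OF car(1)] that(1,2) car I.a_rcos_self by blast
  qed
  \<comment> \<open>Surjectivity lifts the class of \<open>s\<close> to some \<open>r\<close> in
    \<open>R\<close>, which is then traded for the representative \<open>q\<close> of its coset.
    Both errors lie in the ideal of \<open>h u\<close>, so \<open>divide\<close> applies to the
    difference of \<open>x\<close> and \<open>\<iota> q\<close>.\<close>
  have leading_digit: "\<exists>q\<in>Q. \<exists>y\<in>preimage. \<iota> u \<otimes>\<^bsub>L\<^esub> y = x \<ominus>\<^bsub>L\<^esub> \<iota> q" if x: "x \<in> preimage" for x
  proof -
    obtain s where s: "s \<in> carrier S" "\<phi> x = \<iota>' s" and xL: "x \<in> carrier L"
      using x unfolding preimage_def by blast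
    have "PIdl\<^bsub>S\<^esub> (h u) +>\<^bsub>S\<^esub> s \<in> residue_map S h (h u) ` carrier R"
      unfolding onto using s(1) by (auto simp: FactRing_def A_RCOSETS_def')
    then obtain r where r: "r \<in> carrier R" "PIdl\<^bsub>S\<^esub> (h u) +>\<^bsub>S\<^esub> s = PIdl\<^bsub>S\<^esub> (h u) +>\<^bsub>S\<^esub> h r"
      unfolding residue_map_def by blast
    obtain q where q: "q \<in> Q" "q \<in> I +> r" using ex1[OF r(1)] by blast
    have qR: "q \<in> carrier R" using q Qsub by blast
    have "I +> r = I +> q" using q(2) r(1) by (rule I.a_repr_independence')
    then have "h (r \<ominus> q) \<in> PIdl\<^bsub>S\<^esub> (h u)" using I_cong[OF r(1) qR] I_iff by blast
    moreover have "s \<ominus>\<^bsub>S\<^esub> h r \<in> PIdl\<^bsub>S\<^esub> (h u)"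
      using h.S.quotient_eq_iff_same_a_r_cos[OF V.ideal_axioms] r s by blast
    ultimately have "(s \<ominus>\<^bsub>S\<^esub> h r) \<oplus>\<^bsub>S\<^esub> h (r \<ominus> q) \<in> PIdl\<^bsub>S\<^esub> (h u)"
      by (intro V.a_closed)
    also have "(s \<ominus>\<^bsub>S\<^esub> h r) \<oplus>\<^bsub>S\<^esub> h (r \<ominus> q) = s \<ominus>\<^bsub>S\<^esub> h q"
      using s(1) r(1) qR by (simp add: h.R.minus_eq h.S.minus_eq h.S.a_assoc h.S.r_neg1)
    finally have "s \<ominus>\<^bsub>S\<^esub> h q \<in> PIdl\<^bsub>S\<^esub> (h u)" .
    moreover have "\<phi> (x \<ominus>\<^bsub>L\<^esub> \<iota> q) = \<iota>' (s \<ominus>\<^bsub>S\<^esub> h q)"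
      using xL s qR commute by (simp add: \<iota>.S.minus_eq h.S.minus_eq \<iota>'.S.minus_eq)
    moreover have "x \<ominus>\<^bsub>L\<^esub> \<iota> q \<in> carrier L" using xL qR by simp
    ultimately show ?thesis using divide q(1) by blast
  qed
  have contr: "r \<in> I \<longleftrightarrow> (\<exists>y\<in>preimage. \<iota> r = \<iota> u \<otimes>\<^bsub>L\<^esub> y)" if r: "r \<in> carrier R" for r
  proof
    assume "r \<in> I"
    then have "h r \<in> PIdl\<^bsub>S\<^esub> (h u)" using I_iff by blast
    then obtain y where "y \<in> preimage" "\<iota> u \<otimes>\<^bsub>L\<^esub> y = \<iota> r"
      using divide[of "\<iota> r" "h r"] r commute by auto
    then show "\<exists>y\<in>preimage. \<iota> r = \<iota> u \<otimes>\<^bsub>L\<^esub> y" by metis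
  next
    assume "\<exists>y\<in>preimage. \<iota> r = \<iota> u \<otimes>\<^bsub>L\<^esub> y"
    then obtain y where "y \<in> preimage" "\<iota> r = \<iota> u \<otimes>\<^bsub>L\<^esub> y" by blast
    with tors r have "h r \<in> PIdl\<^bsub>S\<^esub> (h u)" by (rule contraction)
    with r show "r \<in> I" using I_iff by blast
  qed
  \<comment> \<open>The image of \<open>S\<close> in \<open>L'\<close> is a subring, and \<phi>
    pulls it back to one.\<close>
  have "subring preimage L"
    unfolding preimage_def using \<iota>'.ring.img_is_subring[OF h.S.carrier_is_subring]
    by (rule \<phi>.ring.subring_preimage)
  moreover have "\<exists>n. \<iota> u [^]\<^bsub>L\<^esub> (n::nat) \<otimes>\<^bsub>L\<^esub> x \<in> \<iota> ` carrier R" if "x \<in> preimage" for x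
    using that denominator unfolding preimage_def by blast
  ultimately show ?thesis
    by (intro digit_expansion.intro digit_expansion_axioms.intro \<iota>.ring_hom_cring_axioms)
      (use u units(1) image_subset_preimage Qsub digits_inj contr leading_digit in blast)+
qed

end

section \<open>The concrete localizations at the powers of \<open>u\<close> and
  \<open>h u\<close>\<close>

lemma localized_hom_localization:
  assumes "ring_hom_cring R S h" and u: "u \<in> carrier R"
  defines "M \<equiv> powers_of R u" and "N \<equiv> powers_of S (h u)"
  shows "localized_hom R S (localization R M) (localization S N) h
    (to_localization R M) (to_localization S N) (localization_map S N h) u"
proof -
  interpret ring_hom_cring R S h by fact
  have M: "submonoid M R" unfolding M_def using u by (rule R.submonoid_powers_of)
  have N: "submonoid N S" unfolding N_def using u by (intro S.submonoid_powers_of) simp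
  interpret M: submonoid M R by fact
  interpret N: submonoid N S by fact
  have MN: "h ` M \<subseteq> N"
    using u by (auto simp: M_def N_def powers_of_def ring.hom_nat_pow)
  have uM: "u \<in> M" unfolding M_def powers_of_def using u by (intro range_eqI[of _ _ 1]) simp
  then have vN: "h u \<in> N" using MN by auto
  interpret \<iota>: ring_hom_cring R "localization R M" "to_localization R M"
    using R.to_localization_hom[OF M] R.cring_axioms R.localization_cring[OF M]
    by (intro ring_hom_cring.intro ring_hom_cring_axioms.intro)
  interpret \<iota>': ring_hom_cring S "localization S N" "to_localization S N"
    using S.to_localization_hom[OF N] S.cring_axioms S.localization_cring[OF N]
    by (intro ring_hom_cring.intro ring_hom_cring_axioms.intro)
  interpret \<phi>: ring_hom_cring "localization R M" "localization S N" "localization_map S N h"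
    using localization_map_hom[OF R.cring_axioms S.cring_axioms homh M N MN]
      R.localization_cring[OF M] S.localization_cring[OF N]
    by (intro ring_hom_cring.intro ring_hom_cring_axioms.intro)
  show ?thesis
  proof
    show "u \<in> carrier R" by fact
    show "to_localization R M u \<in> Units (localization R M)"
      using M uM by (rule R.to_localization_unit)
    show "to_localization S N (h u) \<in> Units (localization S N)"
      using N vN by (rule S.to_localization_unit)
    show "localization_map S N h (to_localization R M r) = to_localization S N (h r)"
      if "r \<in> carrier R" for r
      using localization_map_frac[OF R.cring_axioms S.cring_axioms homh M N MN that M.one_closed]
      by (simp add: to_localization_def)
    show "\<exists>n. to_localization R M u [^]\<^bsub>localization R M\<^esub> (n::nat) \<otimes>\<^bsub>localization R M\<^esub> x
        \<in> to_localization R M ` carrier R" if x: "x \<in> carrier (localization R M)" for x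
    proof -
      obtain a s where a: "a \<in> carrier R" "s \<in> M" "x = fraction R M a s"
        using x by (rule R.localization_cases)
      then obtain n where n: "s = u [^]\<^bsub>R\<^esub> (n::nat)" unfolding M_def powers_of_def by blast
      have "to_localization R M s \<otimes>\<^bsub>localization R M\<^esub> x = to_localization R M a"
        using R.to_localization_unit(2)[OF M a(2,1)] a(3) by simp
      \<comment> \<open>The denominator of \<open>x\<close> is the \<open>n\<close>-th power of
        \<open>u\<close>, so the same \<open>n\<close> clears it.\<close>
      moreover have "to_localization R M s = to_localization R M u [^]\<^bsub>localization R M\<^esub> n"
        unfolding n using u by (rule \<iota>.ring.hom_nat_pow)
      ultimately show ?thesis using a(1) by (intro exI[of _ n]) simp
    qed
    show "\<exists>n. h u [^]\<^bsub>S\<^esub> (n::nat) \<otimes>\<^bsub>S\<^esub> s = h u [^]\<^bsub>S\<^esub> n \<otimes>\<^bsub>S\<^esub> s'"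
      if s: "s \<in> carrier S" "s' \<in> carrier S" and e: "to_localization S N s = to_localization S N s'"
      for s s'
    proof -
      \<comment> \<open>The extra factor in the equality of fractions with denominator one is the
        required power of \<open>h u\<close>.\<close>
      obtain w where "w \<in> N" "w \<otimes>\<^bsub>S\<^esub> s = w \<otimes>\<^bsub>S\<^esub> s'"
        using e s by (auto simp: to_localization_def S.frac_eq_iff[OF N])
      then show ?thesis unfolding N_def powers_of_def by blast
    qed
  qed
qed

section \<open>Expansions and generators of \<phi>\<inverse>S\<close>

theorem theorem10:
  fixes R :: "('a, 'm) ring_scheme" and S :: "('b, 'n) ring_scheme"
    and h :: "'a \<Rightarrow> 'b" and u :: 'a and v :: 'b
    and I Q T :: "'a set" and rep :: "'a \<Rightarrow> 'a"
  assumes "cring R" and "cring S" and "h \<in> ring_hom R S"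
    and "u \<in> carrier R" and "\<forall>x\<in>carrier R. u \<otimes>\<^bsub>R\<^esub> x = \<zero>\<^bsub>R\<^esub> \<longrightarrow> x = \<zero>\<^bsub>R\<^esub>"
    and "v = h u"
    (* automatic if v is regular; without it uniqueness fails, e.g. for R = Z[u], S = Z,
       h u = 0, Q = Z, T = {u}, where v^{-1}S = 0 and all q_{t,i} can be chosen freely *)
    and "\<forall>s\<in>carrier S. \<forall>n::nat. (v [^]\<^bsub>S\<^esub> n) \<otimes>\<^bsub>S\<^esub> s = \<zero>\<^bsub>S\<^esub> \<longrightarrow> s \<in> PIdl\<^bsub>S\<^esub> v"
    and "I = a_kernel R (S Quot (PIdl\<^bsub>S\<^esub> v)) (residue_map S h v)"
    and "coset_representatives R I Q"
    and "T \<subseteq> carrier R"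
    and "\<forall>t\<in>T. rep t \<in> Q \<and> rep t \<in> I +>\<^bsub>R\<^esub> t"
    and "generate_ring R (T \<union> Q) = carrier R"
    and "Idl\<^bsub>R\<^esub> {t \<ominus>\<^bsub>R\<^esub> rep t | t. t \<in> T} = I"
    and "residue_map S h v ` carrier R = carrier (S Quot (PIdl\<^bsub>S\<^esub> v))"
  shows "\<exists>x q. expansion_family R S h u Q T x q \<and>
    (\<forall>x' q'. expansion_family R S h u Q T x' q' \<longrightarrow>
       (\<forall>t\<in>T. \<forall>i. x' t i = x t i \<and> q' t i = q t i)) \<and>
    generate_ring (localization R (powers_of R u))
      (to_localization R (powers_of R u) ` Q \<union> {x t i | t i. t \<in> T})
      = integral_preimage R S h u"
proof -
  have h: "ring_hom_cring R S h"
    using assms(1-3) by (intro ring_hom_cring.intro ring_hom_cring_axioms.intro)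
  let ?L = "localization R (powers_of R u)" and ?\<iota> = "to_localization R (powers_of R u)"
    and ?P = "integral_preimage R S h u"
  interpret loc: localized_hom R S ?L "localization S (powers_of S (h u))" h ?\<iota>
      "to_localization S (powers_of S (h u))" "localization_map S (powers_of S (h u)) h" u
    using h assms(4) by (rule localized_hom_localization)
  have P: "loc.preimage = ?P"
    unfolding loc.preimage_def integral_preimage_def ..
  have tors: "s \<in> PIdl\<^bsub>S\<^esub> (h u)"
    if "s \<in> carrier S" "h u [^]\<^bsub>S\<^esub> (n::nat) \<otimes>\<^bsub>S\<^esub> s = \<zero>\<^bsub>S\<^esub>" for s n
    using assms(7) that unfolding assms(6) by blast
  interpret digit_expansion R ?L ?\<iota> u I Q ?P
    unfolding P[symmetric]
    using tors assms(8) assms(9) assms(14) unfolding assms(6) by (rule loc.digit_expansion)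
  \<comment> \<open>Each \<open>t\<close> is expanded separately; choice then assembles the
    sequences into families indexed by \<open>T\<close>.\<close>
  have "\<forall>t\<in>T. \<exists>y q. y 0 = ?\<iota> t \<and>
      (\<forall>i. y i \<in> ?P \<and> q i \<in> Q \<and> ?\<iota> u \<otimes>\<^bsub>?L\<^esub> y (Suc i) = y i \<ominus>\<^bsub>?L\<^esub> ?\<iota> (q i))"
    using assms(10) image by (intro ballI expansion_exists) auto
  then obtain x q where "\<forall>t\<in>T. x t 0 = ?\<iota> t \<and>
      (\<forall>i. x t i \<in> ?P \<and> q t i \<in> Q \<and> ?\<iota> u \<otimes>\<^bsub>?L\<^esub> x t (Suc i) = x t i \<ominus>\<^bsub>?L\<^esub> ?\<iota> (q t i))"
    by metis
  then have ex: "expansion_family R S h u Q T x q"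
    by (simp add: expansion_family_def)
  \<comment> \<open>Both families start at \<open>?\<iota> t\<close>, so the sequences can be
    compared one \<open>t\<close> at a time.\<close>
  have "x' t i = x t i \<and> q' t i = q t i"
    if "expansion_family R S h u Q T x' q'" "t \<in> T" for x' q' t i
    using expansion_unique[of "x' t" "x t" "q' t" "q t" i] that ex
    by (auto simp: expansion_family_def Let_def)
  moreover have "generate_ring ?L (?\<iota> ` Q \<union> {x t i | t i. t \<in> T}) = ?P"
    using ex assms(10-13)
    by (intro generated_ring_eq[where q = q and rep = rep]) (auto simp: expansion_family_def Let_def)
  ultimately show ?thesis using ex by blast
qed

end
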